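(* Let $(G,D,\star)$ be a complete probabilistic metric space with $G$ nonempty, where $\star$ is a $k$-Lipschitz triangle function ($k\ge1$). Let $f:G\to G$ be a $C$-contraction with constant of contraction $q\in(0,\frac1k)$. Then $f$ has a unique fixed point $x^*\in G$. Moreover, every sequence $(x_n)_{n\ge0}$ in $G$ such that $x_{n+1}=f(x_n)$ for all $n\geq 0$ satisfies, for every $n\ge 0$ and every $t>0$, $$D(x_1,x_0)(t)>1-t\ \Longrightarrow\ D(x_n,x^* )\Big(\tfrac{k(kq)^n}{1-kq}t\Big)>1-\tfrac{k(kq)^n}{1-kq}t,$$ or equivalently, $$d_{\mathcal L}(D(x_n,x^* ),\mathcal H_0)\le\frac{k(kq)^n}{1-kq}\,d_{\mathcal L}(D(x_1,x_0),\mathcal H_0).$$ In particular, $d_{\mathcal L}(D(x_n,x^* ),\mathcal H_0)\to0$ as $n\to+\infty$.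
   Context: $\Delta^+$ is the set of all nondecreasing functions $F:[-\infty,+\infty]\to[0,1]$, left-continuous on $\mathbb R$, with $F(-\infty)=0$, $F(0)=0$, $F(+\infty)=1$. For $a\ge 0$, $\mathcal H_a(t)=0$ if $t\le a$ and $\mathcal H_a(t)=1$ if $t>a$. Order: $F\le L$ iff $F(t)\le L(t)$ for all $t\in\mathbb R$. Modified Lévy distance: for $F,L\in\Delta^+$ and $h>0$ let $A^h_{F,L}=\{t\ge 0: L(t)\le F(t+h)+h\}$, and $d_{\mathcal L}(F,L)=\inf\{h>0:[0,h^{-1})\subset A^h_{F,L}\cap A^h_{L,F}\}$. It is known that $d_{\mathcal L}$ is a metric on $\Delta^+$, that $(\Delta^+,d_{\mathcal L})$ is compact, and that $d_{\mathcal L}(F_n,F)\to0$ iff $F_n(t)\to F(t)$ at every continuity point $t$ of $F$. A triangle function is a binary operation $\star$ on $\Delta^+$ that is commutative, associative, nondecreasing in each place, with neutral element $\mathcal H_0$. It is $k$-Lipschitz if $d_{\mathcal L}(F\star L,F'\star L')\le k(d_{\mathcal L}(F,F')+d_{\mathcal L}(L,L'))$ for all $F,L,F',L'\in\Delta^+$. A probabilistic metric space $(G,D,\star)$ is a set $G$ with a triangle function $\star$ and a map $D:G\times G\to\Delta^+$ such that $D(x,y)=\mathcal H_0$ iff $x=y$; $D(x,y)=D(y,x)$; and $D(x,y)\star D(y,z)\le D(x,z)$ for all $x,y,z\in G$. A sequence $(z_n)$ in $G$ is Cauchy if $\lim_{n,p\to\infty}D(z_n,z_p)(t)=\mathcal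 H_0(t)$ for all $t\in\mathbb R$ (equivalently $d_{\mathcal L}(D(z_n,z_p),\mathcal H_0)\to0$). $(G,D,\star)$ is complete if for every Cauchy sequence $(z_n)$ there is $z_\infty\in G$ with $\lim_n D(z_n,z_\infty)(t)=\mathcal H_0(t)$ for all $t\in\mathbb R$. A map $f:G\to G$ is a $C$-contraction with constant $q\in(0,1)$ if for all $x,y\in G$ and all $t>0$: $D(x,y)(t)>1-t\Rightarrow D(f(x),f(y))(qt)>1-qt$. *)

theory Defs
  imports "HOL-Library.Extended_Real" "HOL-Library.FuncSet"
begin

definition Delta_plus :: "(ereal \<Rightarrow> real) set" where
  "Delta_plus = {F. range F \<subseteq> {0..1} \<and> mono F \<and>
     (\<forall>t::real. continuous (at_left (ereal t)) F) \<and>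
     F (-\<infinity>) = 0 \<and> F 0 = 0 \<and> F \<infinity> = 1}"

definition Heaviside :: "real \<Rightarrow> ereal \<Rightarrow> real" where
  "Heaviside a t = (if t \<le> ereal a then 0 else 1)"

text \<open>The order compares values at real arguments only; all elements of
  \<^const>\<open>Delta_plus\<close> agree at the two infinite points.\<close>

definition dist_le :: "(ereal \<Rightarrow> real) \<Rightarrow> (ereal \<Rightarrow> real) \<Rightarrow> bool" (infix "\<preceq>" 50) where
  "F \<preceq> L \<longleftrightarrow> (\<forall>t::real. F (ereal t) \<le> L (ereal t))"

definition levy_set :: "real \<Rightarrow> (ereal \<Rightarrow> real) \<Rightarrow> (ereal \<Rightarrow> real) \<Rightarrow> real set" where
  "levy_set h F L = {t. 0 \<le> t \<and> L (ereal t) \<le> F (ereal (t + h)) + h}"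

text \<open>For \<open>F\<close>, \<open>L\<close> in \<^const>\<open>Delta_plus\<close> the set below contains \<open>1\<close> and is bounded
  below by \<open>0\<close>, so the real infimum is a genuine one.\<close>

definition levy_dist :: "(ereal \<Rightarrow> real) \<Rightarrow> (ereal \<Rightarrow> real) \<Rightarrow> real" where
  "levy_dist F L = Inf {h. 0 < h \<and> {0..<inverse h} \<subseteq> levy_set h F L \<inter> levy_set h L F}"

locale triangle_function =
  fixes star :: "(ereal \<Rightarrow> real) \<Rightarrow> (ereal \<Rightarrow> real) \<Rightarrow> (ereal \<Rightarrow> real)" (infixl "\<star>" 70)
  assumes star_closed: "\<lbrakk>F \<in> Delta_plus; L \<in> Delta_plus\<rbrakk> \<Longrightarrow> F \<star> L \<in> Delta_plus"
    and star_commute: "\<lbrakk>F \<in> Delta_plus; L \<in> Delta_plus\<rbrakk> \<Longrightarrow> F \<star> L = L \<star> F"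
    and star_assoc: "\<lbrakk>F \<in> Delta_plus; L \<in> Delta_plus; K \<in> Delta_plus\<rbrakk>
          \<Longrightarrow> (F \<star> L) \<star> K = F \<star> (L \<star> K)"
    and star_mono_left: "\<lbrakk>F \<in> Delta_plus; F' \<in> Delta_plus; L \<in> Delta_plus; F \<preceq> F'\<rbrakk>
          \<Longrightarrow> F \<star> L \<preceq> F' \<star> L"
    and star_mono_right: "\<lbrakk>F \<in> Delta_plus; L \<in> Delta_plus; L' \<in> Delta_plus; L \<preceq> L'\<rbrakk>
          \<Longrightarrow> F \<star> L \<preceq> F \<star> L'"
    and star_neutral: "F \<in> Delta_plus \<Longrightarrow> F \<star> Heaviside 0 = F"

definition lipschitz_triangle ::
  "real \<Rightarrow> ((ereal \<Rightarrow> real) \<Rightarrow> (ereal \<Rightarrow> real) \<Rightarrow> (ereal \<Rightarrow> real)) \<Rightarrow> bool" where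
  "lipschitz_triangle k star \<longleftrightarrow>
     (\<forall>F\<in>Delta_plus. \<forall>L\<in>Delta_plus. \<forall>F'\<in>Delta_plus. \<forall>L'\<in>Delta_plus.
        levy_dist (star F L) (star F' L') \<le> k * (levy_dist F F' + levy_dist L L'))"

locale probabilistic_metric_space = triangle_function star
  for star :: "(ereal \<Rightarrow> real) \<Rightarrow> (ereal \<Rightarrow> real) \<Rightarrow> (ereal \<Rightarrow> real)" (infixl "\<star>" 70) +
  fixes G :: "'a set" and D :: "'a \<Rightarrow> 'a \<Rightarrow> ereal \<Rightarrow> real"
  assumes D_closed: "\<lbrakk>x \<in> G; y \<in> G\<rbrakk> \<Longrightarrow> D x y \<in> Delta_plus"
    and D_eq_iff: "\<lbrakk>x \<in> G; y \<in> G\<rbrakk> \<Longrightarrow> D x y = Heaviside 0 \<longleftrightarrow> x = y"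
    and D_sym: "\<lbrakk>x \<in> G; y \<in> G\<rbrakk> \<Longrightarrow> D x y = D y x"
    and D_triangle: "\<lbrakk>x \<in> G; y \<in> G; z \<in> G\<rbrakk> \<Longrightarrow> D x y \<star> D y z \<preceq> D x z"

definition pm_Cauchy :: "'a set \<Rightarrow> ('a \<Rightarrow> 'a \<Rightarrow> ereal \<Rightarrow> real) \<Rightarrow> (nat \<Rightarrow> 'a) \<Rightarrow> bool" where
  "pm_Cauchy G D z \<longleftrightarrow> range z \<subseteq> G \<and>
     (\<forall>t::real. ((\<lambda>(n, p). D (z n) (z p) (ereal t)) \<longlongrightarrow> Heaviside 0 (ereal t))
        (sequentially \<times>\<^sub>F sequentially))"

definition pm_complete :: "'a set \<Rightarrow> ('a \<Rightarrow> 'a \<Rightarrow> ereal \<Rightarrow> real) \<Rightarrow> bool" where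
  "pm_complete G D \<longleftrightarrow> (\<forall>z. pm_Cauchy G D z \<longrightarrow>
     (\<exists>l\<in>G. \<forall>t::real. (\<lambda>n. D (z n) l (ereal t)) \<longlonglongrightarrow> Heaviside 0 (ereal t)))"

definition C_contraction ::
  "'a set \<Rightarrow> ('a \<Rightarrow> 'a \<Rightarrow> ereal \<Rightarrow> real) \<Rightarrow> real \<Rightarrow> ('a \<Rightarrow> 'a) \<Rightarrow> bool" where
  "C_contraction G D q f \<longleftrightarrow> 0 < q \<and> q < 1 \<and> f \<in> G \<rightarrow> G \<and>
     (\<forall>x\<in>G. \<forall>y\<in>G. \<forall>t::real. t > 0 \<longrightarrow>
        D x y (ereal t) > 1 - t \<longrightarrow> D (f x) (f y) (ereal (q * t)) > 1 - q * t)"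

end

theory Submission
  imports Defs
begin

text \<open>Write \<open>\<delta>(x, y)\<close> (\<open>gap x y\<close> below) for the modified Levy distance between \<open>D(x, y)\<close> and \<open>\<H>\<^sub>0\<close>. By left
  continuity, \<open>F(t) > 1 - t\<close> holds iff the distance from \<open>F\<close> to \<open>\<H>\<^sub>0\<close> is less than \<open>t\<close>, so \<open>f\<close>
  contracts \<open>\<delta>\<close> by the factor \<open>q\<close>. Comparing \<open>F \<star> L\<close> with \<open>F \<star> \<H>\<^sub>0 = F\<close>, the Lipschitz condition
  gives \<open>\<delta>(x, z) \<le> \<delta>(x, y) + k \<delta>(y, z)\<close>. As the factor \<open>k\<close> falls on one summand only, it does not
  accumulate along an orbit, and the Banach argument yields even the bound
  \<open>\<delta>(x\<^sub>n, x\<^sup>*) \<le> k q\<^sup>n / (1 - q) \<delta>(x\<^sub>1, x\<^sub>0)\<close>.\<close>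

section \<open>Elementary properties of distance distribution functions\<close>

lemma Delta_plus_mono: "F \<in> Delta_plus \<Longrightarrow> s \<le> t \<Longrightarrow> F s \<le> F t"
  by (auto simp: Delta_plus_def mono_def)

lemma Delta_plus_nonneg: "F \<in> Delta_plus \<Longrightarrow> 0 \<le> F t"
  unfolding Delta_plus_def by (simp add: image_subset_iff)

lemma Delta_plus_le_1: "F \<in> Delta_plus \<Longrightarrow> F t \<le> 1"
  unfolding Delta_plus_def by (simp add: image_subset_iff)

lemma Delta_plus_nonpos: "F \<in> Delta_plus \<Longrightarrow> t \<le> 0 \<Longrightarrow> F t = 0"
  using Delta_plus_mono[of F t 0] Delta_plus_nonneg[of F t] by (auto simp: Delta_plus_def)

lemma Heaviside_0_in_Delta_plus: "Heaviside 0 \<in> Delta_plus"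
proof -
  have "continuous (at_left (ereal t)) (Heaviside 0)" for t
  proof -
    \<comment> \<open>Just to the left of \<open>t\<close> the step function already has its value
      at \<open>t\<close>: on all of \<open>s < t\<close> if \<open>t \<le> 0\<close>, on
      \<open>0 < s < t\<close> otherwise, the jump lying to the right of \<open>0\<close>.\<close>
    have "eventually (\<lambda>s. Heaviside 0 s = Heaviside 0 (ereal t)) (at_left (ereal t))"
    proof (cases "t \<le> 0")
      case True
      then have "Heaviside 0 s = Heaviside 0 (ereal t)" if "s < ereal t" for s
        using less_le_trans[OF that, of 0] by (auto simp: Heaviside_def zero_ereal_def)
      then show ?thesis
        by (auto simp: eventually_at_filter)
    next
      case False
      then have "\<forall>s>0. s < ereal t \<longrightarrow> Heaviside 0 s = Heaviside 0 (ereal t)"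
        by (auto simp: Heaviside_def zero_ereal_def)
      moreover have "0 < ereal t"
        using False by simp
      ultimately show ?thesis
        by (subst eventually_at_left[of 0]) blast+
    qed
    then show ?thesis
      unfolding continuous_within by (rule tendsto_eventually)
  qed
  then show ?thesis
    by (auto simp: Delta_plus_def Heaviside_def mono_def zero_ereal_def intro: order_trans)
qed

section \<open>The modified Levy distance, chiefly to the neutral element\<close>

lemma levy_dist_lessD:
  assumes F: "F \<in> Delta_plus" and L: "L \<in> Delta_plus" and "levy_dist F L < e"
  obtains h where "0 < h" "h < e" "{0..<inverse h} \<subseteq> levy_set h F L \<inter> levy_set h L F"
proof -
  let ?S = "{h. 0 < h \<and> {0..<inverse h} \<subseteq> levy_set h F L \<inter> levy_set h L F}"
  have "L (ereal t) \<le> F (ereal (t + 1)) + 1" "F (ereal t) \<le> L (ereal (t + 1)) + 1" for t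
    using Delta_plus_nonneg Delta_plus_le_1 F L by (meson add_increasing order_trans)+
  then have "1 \<in> ?S"
    by (auto simp: levy_set_def)
  moreover have "bdd_below ?S"
    by (rule bdd_belowI[of _ 0]) auto
  ultimately have "\<exists>h\<in>?S. h < e"
    using assms(3) cInf_less_iff[of ?S e] unfolding levy_dist_def by blast
  then show thesis
    using that by auto
qed

lemma levy_dist_nonneg:
  assumes "F \<in> Delta_plus" "L \<in> Delta_plus"
  shows "0 \<le> levy_dist F L"
proof (rule ccontr)
  assume "\<not> 0 \<le> levy_dist F L"
  then have "levy_dist F L < 0" by simp
  from levy_dist_lessD[OF assms this] show False by force
qed

text \<open>For the second argument \<open>Heaviside 0\<close> one inclusion is automatic because
  \<open>F \<le> 1\<close>. The other says \<open>1 \<le> F (u + h) + h\<close> for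
  \<open>0 < u < 1/h\<close>, and by monotonicity its content lies in small
  \<open>u\<close>.\<close>

lemma levy_dist_Heaviside_less_iff:
  assumes F: "F \<in> Delta_plus" and t: "0 < t"
  shows "levy_dist F (Heaviside 0) < t \<longleftrightarrow> F (ereal t) > 1 - t"
proof
  assume "levy_dist F (Heaviside 0) < t"
  then obtain h where h: "0 < h" "h < t" "{0..<inverse h} \<subseteq> levy_set h F (Heaviside 0)"
    using levy_dist_lessD[OF F Heaviside_0_in_Delta_plus] by (metis le_inf_iff)
  \<comment> \<open>\<open>u\<close> must be positive, as the step function still vanishes at
    \<open>0\<close>; it must also lie in the range \<open>[0, 1/h)\<close> and satisfy
    \<open>u + h \<le> t\<close>.\<close>
  define u where "u = min (t - h) (inverse h / 2)"
  have u: "0 < u" "u + h \<le> t" "u < inverse h"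
    using h by (auto simp: u_def min_def)
  then have "u \<in> levy_set h F (Heaviside 0)"
    using h(3) by auto
  then have "1 \<le> F (ereal (u + h)) + h"
    using u(1) by (auto simp: levy_set_def Heaviside_def)
  moreover have "F (ereal (u + h)) \<le> F (ereal t)"
    using u by (intro Delta_plus_mono[OF F]) auto
  ultimately show "F (ereal t) > 1 - t"
    using h by linarith
next
  assume gt: "F (ereal t) > 1 - t"
  \<comment> \<open>The slack in the strict inequality. Half of it pays for the drop of
    \<open>F\<close> from \<open>t\<close> to \<open>s\<close>, the other half for replacing
    \<open>1 - t\<close> by \<open>1 - s\<close>.\<close>
  define e where "e = F (ereal t) - (1 - t)"
  have "(F \<longlongrightarrow> F (ereal t)) (at_left (ereal t))"
    using F by (auto simp: Delta_plus_def continuous_within)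
  then have "eventually (\<lambda>s. F s > F (ereal t) - e / 2) (at_left (ereal t))"
    using gt by (intro order_tendstoD) (auto simp: e_def)
  then obtain b where b: "b < ereal t" "\<And>s. b < s \<Longrightarrow> s < ereal t \<Longrightarrow> F s > F (ereal t) - e / 2"
    using eventually_at_left[of 0 "ereal t"] t by auto
  obtain r where r: "b < ereal r" "ereal r < ereal t"
    using ereal_dense2[OF b(1)] by auto
  \<comment> \<open>The three entries keep \<open>s\<close> inside the left neighbourhood of
    \<open>t\<close>, within \<open>e / 2\<close> of \<open>t\<close>, and positive.\<close>
  define s where "s = Max {r, t - e / 2, t / 2}"
  have s: "0 < s" "s < t" "t - e / 2 \<le> s" "r \<le> s"
    using r t gt by (auto simp: s_def e_def)
  then have "b < ereal s"
    using r(1) by (meson ereal_less_eq(3) less_le_trans)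
  then have "F (ereal s) > 1 - s"
    using b(2)[of "ereal s"] s(2,3) unfolding e_def by (simp add: field_simps)
  have "{0..<inverse s} \<subseteq> levy_set s F (Heaviside 0) \<inter> levy_set s (Heaviside 0) F"
  proof
    fix u assume u: "u \<in> {0..<inverse s}"
    have "F (ereal s) \<le> F (ereal (u + s))"
      using u by (intro Delta_plus_mono[OF F]) auto
    then show "u \<in> levy_set s F (Heaviside 0) \<inter> levy_set s (Heaviside 0) F"
      using u s(1) \<open>F (ereal s) > 1 - s\<close> Delta_plus_nonneg[OF F, of "ereal (u + s)"]
        Delta_plus_le_1[OF F, of "ereal u"]
      by (auto simp: levy_set_def Heaviside_def)
  qed
  then have "levy_dist F (Heaviside 0) \<le> s"
    unfolding levy_dist_def using s(1)
    by (intro cInf_lower bdd_belowI[of _ 0]) auto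
  then show "levy_dist F (Heaviside 0) < t"
    using s(2) by simp
qed

lemma levy_dist_Heaviside_eq_0:
  assumes F: "F \<in> Delta_plus" and z: "levy_dist F (Heaviside 0) = 0"
  shows "F = Heaviside 0"
proof
  fix s
  have "F (ereal t) = 1" if "0 < t" for t
  proof (rule antisym[OF Delta_plus_le_1[OF F]], rule field_le_epsilon)
    fix e :: real assume "0 < e"
    \<comment> \<open>\<open>u \<le> t\<close> serves monotonicity, \<open>u \<le> e\<close> bounds
      the error in \<open>F u > 1 - u\<close>.\<close>
    define u where "u = min t e"
    have u: "0 < u" "u \<le> t" "u \<le> e"
      using that \<open>0 < e\<close> by (auto simp: u_def)
    have "F (ereal u) \<le> F (ereal t)"
      using u by (intro Delta_plus_mono[OF F]) auto
    then show "1 \<le> F (ereal t) + e"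
      using u levy_dist_Heaviside_less_iff[OF F u(1)] z by simp
  qed
  then show "F s = Heaviside 0 s"
    using F Delta_plus_nonpos[OF F]
    by (cases s) (auto simp: Delta_plus_def Heaviside_def zero_ereal_def)
qed

text \<open>The criterion \<open>F t > 1 - t\<close> passes from a function to any larger
  one.\<close>

lemma levy_dist_Heaviside_antimono:
  assumes F: "F \<in> Delta_plus" and L: "L \<in> Delta_plus" and "F \<preceq> L"
  shows "levy_dist L (Heaviside 0) \<le> levy_dist F (Heaviside 0)"
proof (rule dense_ge)
  fix t assume t: "levy_dist F (Heaviside 0) < t"
  then have "0 < t"
    using levy_dist_nonneg[OF F Heaviside_0_in_Delta_plus] by simp
  then have "L (ereal t) > 1 - t"
    using t levy_dist_Heaviside_less_iff[OF F] assms(3) by (auto simp: dist_le_def intro: less_le_trans)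
  then show "levy_dist L (Heaviside 0) \<le> t"
    using levy_dist_Heaviside_less_iff[OF L \<open>0 < t\<close>] by simp
qed

text \<open>Adding \<open>L s > 1 - s\<close> and \<open>L s \<le> F (s + h) + h\<close> gives the
  criterion for \<open>F\<close> at \<open>s + h\<close>.\<close>

lemma levy_dist_Heaviside_triangle:
  assumes F: "F \<in> Delta_plus" and L: "L \<in> Delta_plus"
  shows "levy_dist F (Heaviside 0) \<le> levy_dist F L + levy_dist L (Heaviside 0)"
proof (rule field_le_epsilon)
  fix e :: real assume e: "0 < e"
  have "levy_dist F L < levy_dist F L + e / 2"
    using e by simp
  then obtain h where h: "0 < h" "h < levy_dist F L + e / 2" "{0..<inverse h} \<subseteq> levy_set h F L"
    using levy_dist_lessD[OF F L] by (metis le_inf_iff)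
  define s where "s = levy_dist L (Heaviside 0) + e / 2"
  have s: "0 < s" "L (ereal s) > 1 - s"
    using e levy_dist_nonneg[OF L Heaviside_0_in_Delta_plus] levy_dist_Heaviside_less_iff[OF L, of s]
    by (auto simp: s_def)
  have "F (ereal (s + h)) > 1 - (s + h)"
  proof (cases "s < inverse h")
    case True
    then have "s \<in> levy_set h F L"
      using h(3) s(1) by auto
    with s(2) show ?thesis
      by (auto simp: levy_set_def)
  next
    case False
    \<comment> \<open>Here \<open>s\<close> is outside the range controlled by \<open>h\<close>. But
      \<open>s * h \<ge> 1\<close> forces \<open>s + h > 1\<close>, so the required lower bound for
      \<open>F\<close> is negative.\<close>
    then have "1 \<le> s * h"
      using h(1) by (simp add: field_simps)
    moreover have "s * h < 1" if "s + h \<le> 1"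
      using that s(1) h(1) mult_strict_mono[of s 1 h 1] by simp
    ultimately show ?thesis
      using Delta_plus_nonneg[OF F, of "ereal (s + h)"] by fastforce
  qed
  then have "levy_dist F (Heaviside 0) < s + h"
    using levy_dist_Heaviside_less_iff[OF F, of "s + h"] s(1) h(1) by simp
  then show "levy_dist F (Heaviside 0) \<le> levy_dist F L + levy_dist L (Heaviside 0) + e"
    using h(2) by (simp add: s_def)
qed

lemma levy_dist_self:
  assumes F: "F \<in> Delta_plus"
  shows "levy_dist F F = 0"
proof (rule antisym[OF dense_ge levy_dist_nonneg[OF F F]])
  fix h :: real assume h: "0 < h"
  have "F (ereal t) \<le> F (ereal (t + h)) + h" for t
    using h Delta_plus_mono[OF F, of "ereal t" "ereal (t + h)"] by simp
  then show "levy_dist F F \<le> h"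
    unfolding levy_dist_def using h
    by (intro cInf_lower bdd_belowI[of _ 0]) (auto simp: levy_set_def)
qed

section \<open>The gap function: triangle inequality, contraction, convergence\<close>

context probabilistic_metric_space
begin

definition gap :: "'a \<Rightarrow> 'a \<Rightarrow> real" where
  "gap x y = levy_dist (D x y) (Heaviside 0)"

lemma gap_nonneg: "x \<in> G \<Longrightarrow> y \<in> G \<Longrightarrow> 0 \<le> gap x y"
  by (simp add: gap_def levy_dist_nonneg D_closed Heaviside_0_in_Delta_plus)

lemma gap_sym: "x \<in> G \<Longrightarrow> y \<in> G \<Longrightarrow> gap x y = gap y x"
  by (metis gap_def D_sym)

lemma gap_less_iff: "x \<in> G \<Longrightarrow> y \<in> G \<Longrightarrow> 0 < t \<Longrightarrow> gap x y < t \<longleftrightarrow> D x y (ereal t) > 1 - t"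
  by (simp add: gap_def levy_dist_Heaviside_less_iff D_closed)

lemma gap_self: "x \<in> G \<Longrightarrow> gap x x = 0"
  using D_eq_iff[of x x] by (simp add: gap_def levy_dist_self Heaviside_0_in_Delta_plus)

lemma gap_eq_0D: "x \<in> G \<Longrightarrow> y \<in> G \<Longrightarrow> gap x y = 0 \<Longrightarrow> x = y"
  using levy_dist_Heaviside_eq_0 D_eq_iff D_closed unfolding gap_def by blast

lemma gap_triangle:
  assumes lip: "lipschitz_triangle k star" and G: "x \<in> G" "y \<in> G" "z \<in> G"
  shows "gap x z \<le> gap x y + k * gap y z"
proof -
  note H = Heaviside_0_in_Delta_plus and cl = star_closed D_closed G
  have "gap x z \<le> levy_dist (D x y \<star> D y z) (Heaviside 0)"
    unfolding gap_def using D_triangle[of x y z] cl by (intro levy_dist_Heaviside_antimono) auto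
  also have "\<dots> \<le> levy_dist (D x y \<star> D y z) (D x y) + gap x y"
    unfolding gap_def using cl by (intro levy_dist_Heaviside_triangle) auto
  finally have "gap x z \<le> levy_dist (D x y \<star> D y z) (D x y) + gap x y" .
  \<comment> \<open>Both products share the left factor, so the Lipschitz bound charges only for
    moving \<open>D y z\<close> to \<open>Heaviside 0\<close>.\<close>
  moreover have "levy_dist (D x y \<star> D y z) (D x y \<star> Heaviside 0)
      \<le> k * (levy_dist (D x y) (D x y) + gap y z)"
    using lip cl H unfolding lipschitz_triangle_def gap_def by blast
  ultimately show ?thesis
    using star_neutral levy_dist_self cl by simp
qed

text \<open>By \<open>gap_less_iff\<close> the hypothesis on \<open>f\<close> turns
  \<open>gap x y < t\<close> into \<open>gap (f x) (f y) < q * t\<close>; then \<open>t\<close>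
  decreases to \<open>gap x y\<close>.\<close>

lemma gap_contraction:
  assumes f: "C_contraction G D q f" and G: "x \<in> G" "y \<in> G"
  shows "gap (f x) (f y) \<le> q * gap x y"
proof -
  have q: "0 < q" and fG: "f x \<in> G" "f y \<in> G"
    using f G by (auto simp: C_contraction_def)
  have "gap (f x) (f y) / q \<le> gap x y"
  proof (rule dense_ge)
    fix t assume t: "gap x y < t"
    then have "0 < t"
      using gap_nonneg[OF G] by simp
    then have "D (f x) (f y) (ereal (q * t)) > 1 - q * t"
      using f G t gap_less_iff[OF G] by (simp add: C_contraction_def)
    then have "gap (f x) (f y) < q * t"
      using gap_less_iff[OF fG] q \<open>0 < t\<close> by simp
    then show "gap (f x) (f y) / q \<le> t"
      using q by (simp add: field_simps)
  qed
  then show ?thesis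
    using q by (simp add: field_simps)
qed

text \<open>To get below \<open>e\<close>, convergence at the single argument \<open>e\<close>
  suffices: there the limit is \<open>1 > 1 - e\<close>.\<close>

lemma gap_limit:
  assumes "range z \<subseteq> G" "l \<in> G"
    and lim: "\<And>t::real. (\<lambda>n. D (z n) l (ereal t)) \<longlonglongrightarrow> Heaviside 0 (ereal t)"
  shows "(\<lambda>n. gap (z n) l) \<longlonglongrightarrow> 0"
proof (rule order_tendstoI)
  fix e :: real assume e: "0 < e"
  then have "eventually (\<lambda>n. D (z n) l (ereal e) > 1 - e) sequentially"
    using lim[of e] by (intro order_tendstoD) (auto simp: Heaviside_def)
  then show "eventually (\<lambda>n. gap (z n) l < e) sequentially"
    by (rule eventually_mono) (use e assms(1,2) gap_less_iff in blast)
next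
  fix e :: real assume "e < 0"
  then show "eventually (\<lambda>n. e < gap (z n) l) sequentially"
    using assms(1,2) gap_nonneg
    by (intro always_eventually allI) (meson less_le_trans rangeI subsetD)
qed

lemma pm_CauchyI:
  assumes z: "range z \<subseteq> G"
    and gap: "\<And>e. 0 < e \<Longrightarrow> \<exists>N. \<forall>m\<ge>N. \<forall>n\<ge>N. gap (z m) (z n) < e"
  shows "pm_Cauchy G D z"
  unfolding pm_Cauchy_def
proof (intro conjI z allI)
  fix t :: real
  have zG: "z n \<in> G" for n
    using z by auto
  show "((\<lambda>(n, p). D (z n) (z p) (ereal t)) \<longlongrightarrow> Heaviside 0 (ereal t))
      (sequentially \<times>\<^sub>F sequentially)"
  proof (cases "t \<le> 0")
    case True
    then have "D (z n) (z p) (ereal t) = Heaviside 0 (ereal t)" for n p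
      using Delta_plus_nonpos[OF D_closed[OF zG zG]] by (simp add: Heaviside_def)
    then show ?thesis
      by (simp add: case_prod_unfold)
  next
    case False
    then have t: "Heaviside 0 (ereal t) = 1" "0 < t"
      by (auto simp: Heaviside_def)
    show ?thesis
      unfolding t(1) tendsto_iff
    proof (intro allI impI)
      fix e :: real assume "0 < e"
      \<comment> \<open>One level for two purposes: at most \<open>t\<close> to compare arguments of
        \<open>D\<close>, at most \<open>e\<close> to bound its distance from
        \<open>1\<close>.\<close>
      then have s: "0 < min t e"
        using t(2) by simp
      from gap[OF s] obtain N where N: "gap (z m) (z n) < min t e" if "m \<ge> N" "n \<ge> N" for m n
        by blast
      have "dist (D (z m) (z n) (ereal t)) 1 < e" if "m \<ge> N" "n \<ge> N" for m n
      proof -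
        have "D (z m) (z n) (ereal (min t e)) > 1 - min t e"
          using N[OF that] gap_less_iff[OF zG zG s] by simp
        moreover have "D (z m) (z n) (ereal (min t e)) \<le> D (z m) (z n) (ereal t)"
          by (intro Delta_plus_mono[OF D_closed[OF zG zG]]) simp
        moreover have "D (z m) (z n) (ereal t) \<le> 1"
          by (rule Delta_plus_le_1[OF D_closed[OF zG zG]])
        ultimately show ?thesis
          by (simp add: dist_real_def)
      qed
      then show "eventually (\<lambda>u. dist (case u of (n, p) \<Rightarrow> D (z n) (z p) (ereal t)) 1 < e)
          (sequentially \<times>\<^sub>F sequentially)"
        by (auto simp: eventually_prod_sequentially)
    qed
  qed
qed

section \<open>Contractions and their orbits\<close>

context
  fixes k q :: real and f :: "'a \<Rightarrow> 'a"
  assumes lip: "lipschitz_triangle k star" and k: "0 \<le> k"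
    and f: "C_contraction G D q f"
begin

lemma contraction_closed: "x \<in> G \<Longrightarrow> f x \<in> G"
  using f by (auto simp: C_contraction_def)

lemma contraction_const: "0 < q" "q < 1"
  using f by (auto simp: C_contraction_def)

lemma fixed_point_unique:
  assumes "x \<in> G" "y \<in> G" "f x = x" "f y = y"
  shows "x = y"
proof -
  have "(1 - q) * gap x y \<le> 0"
    using gap_contraction[OF f assms(1,2)] assms(3,4) by (simp add: algebra_simps)
  then have "gap x y = 0"
    using contraction_const gap_nonneg[OF assms(1,2)] by (simp add: mult_le_0_iff)
  then show ?thesis
    using gap_eq_0D assms by blast
qed

context
  fixes x :: "nat \<Rightarrow> 'a"
  assumes x: "\<And>n. x n \<in> G" "\<And>n. x (Suc n) = f (x n)"
begin

lemma gap_orbit_Suc: "gap (x n) (x (Suc n)) \<le> q ^ n * gap (x 1) (x 0)"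
proof (induction n)
  case (Suc n)
  have "gap (x (Suc n)) (x (Suc (Suc n))) \<le> q * gap (x n) (x (Suc n))"
    using gap_contraction[OF f x(1) x(1), of n "Suc n"] x(2) by simp
  also have "\<dots> \<le> q * (q ^ n * gap (x 1) (x 0))"
    using Suc contraction_const by (intro mult_left_mono) auto
  finally show ?case by simp
qed (simp add: gap_sym x(1))

text \<open>Splitting off the first step leaves the bound for \<open>n + 1\<close>, and
  \<open>k q^(n+1) / (1 - q) + k q^n = k q^n / (1 - q)\<close>, so a bound independent of
  \<open>p\<close> reproduces itself.\<close>

lemma gap_orbit: "gap (x n) (x (n + p)) \<le> k * q ^ n / (1 - q) * gap (x 1) (x 0)"
proof (induction p arbitrary: n)
  case 0
  show ?case
    using k contraction_const gap_nonneg x(1) by (simp add: gap_self)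
next
  case (Suc p)
  \<comment> \<open>The order is reversed so that the factor \<open>k\<close> of
    \<open>gap_triangle\<close> falls on the single step and not on the long remainder.\<close>
  have "gap (x n) (x (n + Suc p)) = gap (x (Suc n + p)) (x n)"
    using gap_sym x(1) by simp
  also have "\<dots> \<le> gap (x (Suc n + p)) (x (Suc n)) + k * gap (x (Suc n)) (x n)"
    by (rule gap_triangle[OF lip x(1) x(1) x(1)])
  also have "\<dots> = gap (x (Suc n)) (x (Suc n + p)) + k * gap (x n) (x (Suc n))"
    using gap_sym x(1) by simp
  also have "\<dots> \<le> k * q ^ Suc n / (1 - q) * gap (x 1) (x 0) + k * (q ^ n * gap (x 1) (x 0))"
    by (intro add_mono Suc mult_left_mono gap_orbit_Suc k)
  also have "\<dots> = k * q ^ n / (1 - q) * gap (x 1) (x 0)"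
    using contraction_const by (simp add: field_simps)
  finally show ?case .
qed

lemma pm_Cauchy_orbit: "pm_Cauchy G D x"
proof (rule pm_CauchyI)
  fix e :: real assume e: "0 < e"
  have "(\<lambda>n. k * q ^ n / (1 - q) * gap (x 1) (x 0)) \<longlonglongrightarrow> k * 0 / (1 - q) * gap (x 1) (x 0)"
    using contraction_const by (intro tendsto_intros LIMSEQ_power_zero) auto
  then have "eventually (\<lambda>n. k * q ^ n / (1 - q) * gap (x 1) (x 0) < e) sequentially"
    using e by (intro order_tendstoD) auto
  then obtain N where N: "k * q ^ n / (1 - q) * gap (x 1) (x 0) < e" if "n \<ge> N" for n
    by (auto simp: eventually_sequentially)
  have *: "gap (x m) (x n) < e" if "m \<ge> N" "m \<le> n" for m n
    using gap_orbit[of m "n - m"] N[of m] that by simp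
  have "gap (x m) (x n) < e" if "m \<ge> N" "n \<ge> N" for m n
    using *[of m n] *[of n m] that gap_sym x(1) by (cases "m \<le> n") auto
  then show "\<exists>N. \<forall>m\<ge>N. \<forall>n\<ge>N. gap (x m) (x n) < e"
    by blast
qed (use x in auto)

lemma orbit_limit:
  assumes l: "l \<in> G" "(\<lambda>n. gap (x n) l) \<longlonglongrightarrow> 0"
  shows "f l = l" "gap (x n) l \<le> k * q ^ n / (1 - q) * gap (x 1) (x 0)"
proof -
  have fl: "f l \<in> G"
    using l contraction_closed by simp
  have "gap (f l) l \<le> 0"
  proof (rule LIMSEQ_le_const)
    show "(\<lambda>n. q * gap (x n) l + k * gap (x (Suc n)) l) \<longlonglongrightarrow> 0"
      using LIMSEQ_Suc[OF l(2)] l(2) by (auto intro!: tendsto_eq_intros)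
    \<comment> \<open>The intermediate point is \<open>x (Suc n) = f (x n)\<close>, whose gap to
      \<open>f l\<close> is contracted from that of \<open>x n\<close> to \<open>l\<close>.\<close>
    have "gap (f l) l \<le> q * gap (x n) l + k * gap (x (Suc n)) l" for n
      using gap_triangle[OF lip fl x(1) l(1), of "Suc n"] gap_contraction[OF f x(1) l(1), of n]
        gap_sym[OF fl x(1), of "Suc n"] x(2) by simp
    then show "\<exists>N. \<forall>n\<ge>N. gap (f l) l \<le> q * gap (x n) l + k * gap (x (Suc n)) l"
      by blast
  qed
  then show "f l = l"
    using gap_nonneg[OF fl l(1)] gap_eq_0D[OF fl l(1)] by simp
  show "gap (x n) l \<le> k * q ^ n / (1 - q) * gap (x 1) (x 0)"
  proof (rule LIMSEQ_le_const)
    show "(\<lambda>p. k * q ^ n / (1 - q) * gap (x 1) (x 0) + k * gap (x (p + n)) l)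
        \<longlonglongrightarrow> k * q ^ n / (1 - q) * gap (x 1) (x 0)"
      using LIMSEQ_ignore_initial_segment[OF l(2), of n] contraction_const
      by (auto intro!: tendsto_eq_intros)
    \<comment> \<open>With \<open>x (n + p)\<close> in between, \<open>k\<close> multiplies only the
      term that vanishes as \<open>p\<close> grows, so the constant survives the limit.\<close>
    have "gap (x n) l \<le> k * q ^ n / (1 - q) * gap (x 1) (x 0) + k * gap (x (p + n)) l" for p
      using gap_triangle[OF lip x(1) x(1) l(1), of n "p + n"] gap_orbit[of n p]
      by (simp add: add.commute)
    then show "\<exists>N. \<forall>p\<ge>N. gap (x n) l
        \<le> k * q ^ n / (1 - q) * gap (x 1) (x 0) + k * gap (x (p + n)) l"
      by blast
  qed
qed

lemma orbit_converges:
  assumes "pm_complete G D"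
  obtains l where "l \<in> G" "(\<lambda>n. gap (x n) l) \<longlonglongrightarrow> 0"
proof -
  obtain l where "l \<in> G" "\<And>t::real. (\<lambda>n. D (x n) l (ereal t)) \<longlonglongrightarrow> Heaviside 0 (ereal t)"
    using assms pm_Cauchy_orbit unfolding pm_complete_def by blast
  then show thesis
    using that gap_limit[of x l] x(1) by blast
qed

end

end

end

theorem theorem3:
  fixes G :: "'a set" and D :: "'a \<Rightarrow> 'a \<Rightarrow> ereal \<Rightarrow> real"
    and star :: "(ereal \<Rightarrow> real) \<Rightarrow> (ereal \<Rightarrow> real) \<Rightarrow> (ereal \<Rightarrow> real)"
    and k q :: real and f :: "'a \<Rightarrow> 'a"
  assumes "probabilistic_metric_space star G D"
    and "pm_complete G D"
    and "G \<noteq> {}"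
    and "k \<ge> 1" and "lipschitz_triangle k star"
    and "C_contraction G D q f"
    and "0 < q" and "q < 1 / k"
  shows "\<exists>xs\<in>G. f xs = xs \<and> (\<forall>y\<in>G. f y = y \<longrightarrow> y = xs) \<and>
    (\<forall>x :: nat \<Rightarrow> 'a. (\<forall>n. x n \<in> G) \<and> (\<forall>n. x (Suc n) = f (x n)) \<longrightarrow>
      (\<forall>n. \<forall>t::real. t > 0 \<longrightarrow>
         D (x 1) (x 0) (ereal t) > 1 - t \<longrightarrow>
         D (x n) xs (ereal (k * (k * q) ^ n / (1 - k * q) * t))
           > 1 - k * (k * q) ^ n / (1 - k * q) * t) \<and>
      (\<forall>n. levy_dist (D (x n) xs) (Heaviside 0)
         \<le> k * (k * q) ^ n / (1 - k * q) * levy_dist (D (x 1) (x 0)) (Heaviside 0)) \<and>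
      (\<lambda>n. levy_dist (D (x n) xs) (Heaviside 0)) \<longlonglongrightarrow> 0)"
proof -
  interpret probabilistic_metric_space star G D by fact
  note f = \<open>C_contraction G D q f\<close> and complete = \<open>pm_complete G D\<close>
    and lip = \<open>lipschitz_triangle k star\<close>
  have k: "0 \<le> k" and q: "0 < q" "q < 1" "q \<le> k * q" "k * q < 1"
    using assms(4,7,8) f by (auto simp: field_simps C_contraction_def)
  have fG: "f y \<in> G" if "y \<in> G" for y
    using contraction_closed[OF lip k f that] .
  define c where "c n = k * (k * q) ^ n / (1 - k * q)" for n
  have c_pos: "0 < c n" for n
    using assms(4) q by (auto simp: c_def)
  \<comment> \<open>Since \<open>q \<le> k q < 1\<close>, passing from \<open>q\<close> to
    \<open>k q\<close> enlarges the numerator and shrinks the denominator.\<close>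
  have bound: "k * q ^ n / (1 - q) \<le> c n" for n
    unfolding c_def using k q by (intro frac_le mult_left_mono power_mono) auto
  obtain x0 where "x0 \<in> G"
    using \<open>G \<noteq> {}\<close> by auto
  define z where "z n = (f ^^ n) x0" for n
  have z: "z n \<in> G" "z (Suc n) = f (z n)" for n
    using \<open>x0 \<in> G\<close> by (induction n) (auto simp: z_def fG)
  obtain xs where xs: "xs \<in> G" "(\<lambda>n. gap (z n) xs) \<longlonglongrightarrow> 0"
    by (rule orbit_converges[where x = z, OF lip k f z complete])
  have fixed: "f xs = xs"
    by (rule orbit_limit(1)[where x = z, OF lip k f z xs])
  have main: "gap (x n) xs \<le> c n * gap (x 1) (x 0)" "(\<lambda>n. gap (x n) xs) \<longlonglongrightarrow> 0"
    if x: "\<And>n. x n \<in> G" "\<And>n. x (Suc n) = f (x n)" for x n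
  proof -
    obtain l where l: "l \<in> G" "(\<lambda>n. gap (x n) l) \<longlonglongrightarrow> 0"
      using orbit_converges[where x = x, OF lip k f x complete] by blast
    note lim = orbit_limit[where x = x, OF lip k f x l]
    \<comment> \<open>\<open>xs\<close> arose from one chosen orbit. The limit of any other orbit is
      also a fixed point, so uniqueness identifies the two.\<close>
    have "l = xs"
      using fixed_point_unique[OF lip k f l(1) xs(1) lim(1) fixed] .
    moreover have "k * q ^ n / (1 - q) * gap (x 1) (x 0) \<le> c n * gap (x 1) (x 0)"
      using bound gap_nonneg x(1) by (intro mult_right_mono) auto
    ultimately show "gap (x n) xs \<le> c n * gap (x 1) (x 0)" "(\<lambda>n. gap (x n) xs) \<longlonglongrightarrow> 0"
      using l(2) lim(2)[of n] by auto
  qed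
  have level: "D (x n) xs (ereal (c n * t)) > 1 - c n * t"
    if x: "\<And>n. x n \<in> G" "\<And>n. x (Suc n) = f (x n)"
      and t: "0 < t" "D (x 1) (x 0) (ereal t) > 1 - t" for x n t
  proof -
    \<comment> \<open>The pointwise form is the gap bound read through \<open>gap_less_iff\<close>;
      positivity of \<open>c n\<close> keeps the inequality strict and the new level
      positive.\<close>
    have "c n * gap (x 1) (x 0) < c n * t"
      using t gap_less_iff[OF x(1) x(1) t(1)] c_pos by simp
    then have "gap (x n) xs < c n * t"
      using main(1)[of x n, OF x] by simp
    then show ?thesis
      using gap_less_iff[OF x(1) xs(1)] c_pos t(1) by simp
  qed
  show ?thesis
  proof (intro bexI[of _ xs] conjI allI ballI impI; (elim conjE)?)
    show "f xs = xs" "xs \<in> G"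
      by fact+
    show "y = xs" if "y \<in> G" "f y = y" for y
      using fixed_point_unique[OF lip k f that(1) xs(1) that(2) fixed] .
  next
    fix x :: "nat \<Rightarrow> 'a" and n t
    assume x: "\<forall>n. x n \<in> G" "\<forall>n. x (Suc n) = f (x n)"
    show "D (x n) xs (ereal (k * (k * q) ^ n / (1 - k * q) * t))
        > 1 - k * (k * q) ^ n / (1 - k * q) * t"
      if "0 < t" "D (x 1) (x 0) (ereal t) > 1 - t"
      using level[of x t n] x that unfolding c_def by blast
    show "levy_dist (D (x n) xs) (Heaviside 0)
        \<le> k * (k * q) ^ n / (1 - k * q) * levy_dist (D (x 1) (x 0)) (Heaviside 0)"
      using main(1)[of x n] x unfolding gap_def c_def by blast
    show "(\<lambda>n. levy_dist (D (x n) xs) (Heaviside 0)) \<longlonglongrightarrow> 0"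
      using main(2)[of x] x unfolding gap_def by blast
  qed
qed

end
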